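(* Let $A\in\mathbb R^{n\times n}$ be stable and fix a frequency $\omega\in[0,\infty)$. Let $$\kappa(\omega)=\max_{\delta\in[-1,1]}\overline\sigma\left(\left(j\omega I-\left(\tfrac{1-\delta}{1+\delta}A-I\right)\right)^{-1}\right),$$ where the matrix is understood to be zero for $\delta=-1$. For $\epsilon>0$ let $\gamma_\epsilon$ be the optimal value (infimum) of the one-dimensional optimization program $$\begin{array}{ll}\text{minimize} & \gamma>0\\ \text{subject to} & \mu_{\mathbf\Delta}\left(P(j\omega)\begin{bmatrix}I_n&0\\0&I_n/\gamma\end{bmatrix}\right)\le 1-\epsilon,\end{array}$$ where $\mu_{\mathbf\Delta}$ is the structured singular value with respect to the block structure $\mathrm{diag}(\delta I_n,\Delta_p)$ with $\delta\in\mathbb R$ and $\Delta_p\in\mathbb C^{n\times n}$. Then $\kappa(\omega)$ is obtained with arbitrary precision as the value of this program, that is, $\gamma_\epsilon\to\kappa(\omega)$ as $\epsilon\to0^+$.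
   Context: A matrix is stable if all its eigenvalues have strictly negative real part; $\overline\sigma$ and $\|\cdot\|$ denote the maximum singular value; $j$ is the imaginary unit. $P(s)$ is the $2n\times 2n$ transfer function from $(w_\delta,w)$ to $(z_\delta,z)$ of the system $$\dot x=Ax-x+\sqrt2\,w_\delta+w,\qquad z_\delta=-\sqrt2\,Ax-w_\delta,\qquad z=x,$$ i.e. $$P(s)=\begin{bmatrix}-I_n&0\\0&0\end{bmatrix}+\begin{bmatrix}-\sqrt2\,A\\ I_n\end{bmatrix}\left(sI_n-(A-I_n)\right)^{-1}\begin{bmatrix}\sqrt2\,I_n& I_n\end{bmatrix}.$$ The block structure is $\mathbf\Delta=\{\mathrm{diag}(\delta I_n,\Delta_p):\delta\in\mathbb R,\ \Delta_p\in\mathbb C^{n\times n}\}$, and for $M\in\mathbb C^{2n\times2n}$ the structured singular value is $$\mu_{\mathbf\Delta}(M)=\frac1{\inf\{\|\Delta\|:\Delta\in\mathbf\Delta,\ \det(I-M\Delta)=0\}},$$ with $\inf\emptyset=+\infty$, so that $\mu_{\mathbf\Delta}(M)=0$ if no $\Delta\in\mathbf\Delta$ makes $I-M\Delta$ singular. By convention the infimum of an infeasible program is $+\infty$. *)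

theory Defs
  imports "HOL-Analysis.Analysis"
begin

definition eigenvalue :: "complex^'n^'n \<Rightarrow> complex \<Rightarrow> bool" where
  "eigenvalue M l \<longleftrightarrow> (\<exists>v. v \<noteq> 0 \<and> M *v v = l *s v)"

abbreviation cmat :: "real^'n^'m \<Rightarrow> complex^'n^'m" where
  "cmat \<equiv> map_matrix complex_of_real"

definition stable :: "real^'n^'n \<Rightarrow> bool" where
  "stable A \<longleftrightarrow> (\<forall>l. eigenvalue (cmat A) l \<longrightarrow> Re l < 0)"

definition conj_transpose :: "complex^'n^'m \<Rightarrow> complex^'m^'n" where
  "conj_transpose M = (\<chi> i j. cnj (M $ j $ i))"

(* The eigenvalues of M^* M are real and nonnegative, so Re only changes the type. *)
definition singular_values :: "complex^'n^'n \<Rightarrow> real set" where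
  "singular_values M = {sqrt (Re l) | l. eigenvalue (conj_transpose M ** M) l}"

definition max_singular_value :: "complex^'n^'n \<Rightarrow> real" where
  "max_singular_value M = Max (singular_values M)"

text \<open>Matrices of size \<open>2n \<times> 2n\<close> are indexed by the sum type \<open>'n + 'n\<close>: \<open>Inl\<close> is the
  first block of indices and \<open>Inr\<close> the second.\<close>

definition row_block :: "'a^'n^'p \<Rightarrow> 'a^'m^'p \<Rightarrow> 'a^('n + 'm)^'p" where
  "row_block A B = (\<chi> i j. case j of Inl b \<Rightarrow> A $ i $ b | Inr b \<Rightarrow> B $ i $ b)"

definition col_block :: "'a^'n^'p \<Rightarrow> 'a^'n^'q \<Rightarrow> 'a^'n^('p + 'q)" where
  "col_block A B = (\<chi> i. case i of Inl a \<Rightarrow> A $ a | Inr a \<Rightarrow> B $ a)"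

definition block :: "'a^'n^'p \<Rightarrow> 'a^'m^'p \<Rightarrow> 'a^'n^'q \<Rightarrow> 'a^'m^'q \<Rightarrow> 'a^('n + 'm)^('p + 'q)" where
  "block A B C D = col_block (row_block A B) (row_block C D)"

definition transfer_P :: "real^'n^'n \<Rightarrow> complex \<Rightarrow> complex^('n + 'n)^('n + 'n)" where
  "transfer_P A s =
     block (- mat 1) 0 0 0
     + col_block (- sqrt 2 *\<^sub>R cmat A) (mat 1)
       ** matrix_inv (mat s - (cmat A - mat 1))
       ** row_block (sqrt 2 *\<^sub>R mat 1) (mat 1)"

definition uncertainty_set :: "(complex^('n::finite + 'n)^('n + 'n)) set" where
  "uncertainty_set = {block (mat (complex_of_real d)) 0 0 D | d D. True}"

(* In ereal, Inf {} = \<infinity> and 1 / \<infinity> = 0. *)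
definition mu :: "complex^('n::finite + 'n)^('n + 'n) \<Rightarrow> ereal" where
  "mu M = 1 / Inf {ereal (max_singular_value D) | D.
                     D \<in> uncertainty_set \<and> det (mat 1 - M ** D) = 0}"

definition resolvent :: "real^'n^'n \<Rightarrow> real \<Rightarrow> real \<Rightarrow> complex^'n^'n" where
  "resolvent A \<omega> d =
     (if d = -1 then 0
      else matrix_inv (mat (\<i> * complex_of_real \<omega>) - (((1 - d) / (1 + d)) *\<^sub>R cmat A - mat 1)))"

definition kappa :: "real^'n^'n \<Rightarrow> real \<Rightarrow> real" where
  "kappa A \<omega> = (SUP d\<in>{-1..1}. max_singular_value (resolvent A \<omega> d))"

definition gamma_opt :: "real^'n^'n \<Rightarrow> real \<Rightarrow> real \<Rightarrow> ereal" where
  "gamma_opt A \<omega> \<epsilon> = Inf {ereal \<gamma> | \<gamma>. \<gamma> > 0 \<and>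
     mu (transfer_P A (\<i> * complex_of_real \<omega>)
         ** block (mat 1) 0 0 (mat (complex_of_real (1 / \<gamma>)))) \<le> ereal (1 - \<epsilon>)}"

end

theory Submission
  imports Defs
begin

text \<open>Write \<open>s = \<i> \<omega>\<close> and \<open>N(\<delta>) = (1 + \<delta>) (s + 1) I - (1 - \<delta>) A\<close>. Eliminating the \<open>\<delta>\<close>-channel of the
  feedback loop shows that \<open>diag(\<delta> I, E)\<close> makes the loop singular iff \<open>N(\<delta>) x = (1 + \<delta>) E x\<close> for
  some \<open>x \<noteq> 0\<close>, so the least norm of such an \<open>E\<close> is \<open>1 / f(\<delta>)\<close>, where \<open>f(\<delta>)\<close> is the norm of
  \<open>(1 + \<delta>) N(\<delta>)\<^sup>-\<^sup>1\<close>. On \<open>[-1, 1]\<close> this is the norm of the resolvent, also at \<open>\<delta> = -1\<close>. With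
  \<open>R = 1 / (1 - \<epsilon>)\<close>, a value \<open>\<gamma>\<close> is feasible iff \<open>\<gamma> \<ge> R f(\<delta>)\<close> for all \<open>\<bar>\<delta>\<bar> < R\<close>. Stability of \<open>A\<close>
  makes \<open>N\<close> invertible on \<open>[-1, 1]\<close>, hence near it by compactness, and the continuity of \<open>f\<close> gives
  the limit as \<open>R \<rightarrow> 1\<close>.\<close>

section \<open>The maximum singular value as an operator norm\<close>

lemma of_real_vector_scalar_mult:
  fixes v :: "complex^'n"
  shows "complex_of_real r *s v = r *\<^sub>R v"
  by (simp add: vec_eq_iff scaleR_conv_of_real[where 'a=complex])

text \<open>Here \<open>\<bullet>\<close> is the real part of the Hermitian inner product, and
  adjointness survives taking real parts.\<close>

lemma inner_matrix_vector_adjoint: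
  fixes M :: "complex^'n^'m"
  shows "(M *v x) \<bullet> y = x \<bullet> (conj_transpose M *v y)"
proof -
  have *: "(a * b) \<bullet> c = b \<bullet> (cnj a * c)" for a b c :: complex
    by (simp add: inner_complex_def algebra_simps)
  have "(M *v x) \<bullet> y = (\<Sum>i\<in>UNIV. \<Sum>j\<in>UNIV. x $ j \<bullet> (cnj (M $ i $ j) * y $ i))"
    by (simp add: inner_vec_def matrix_vector_mult_def inner_sum_left *)
  also have "\<dots> = (\<Sum>j\<in>UNIV. \<Sum>i\<in>UNIV. x $ j \<bullet> (cnj (M $ i $ j) * y $ i))"
    by (rule sum.swap)
  also have "\<dots> = x \<bullet> (conj_transpose M *v y)"
    by (simp add: inner_vec_def matrix_vector_mult_def conj_transpose_def inner_sum_right)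
  finally show ?thesis .
qed

lemma inner_gram:
  fixes M :: "complex^'n^'m"
  shows "((conj_transpose M ** M) *v x) \<bullet> y = (M *v x) \<bullet> (M *v y)"
  by (metis inner_commute inner_matrix_vector_adjoint matrix_vector_mul_assoc)

lemma vector_scalar_mult_inner_self:
  fixes v :: "complex^'n"
  shows "(l *s v) \<bullet> v = Re l * (norm v)\<^sup>2"
proof -
  have "(l * a) \<bullet> a = Re l * (a \<bullet> a)" for a
    by (simp add: inner_complex_def algebra_simps)
  then show ?thesis
    by (simp add: inner_vec_def power2_norm_eq_inner sum_distrib_left)
qed

text \<open>Pairing with \<open>\<i> *s v\<close> instead of \<open>v\<close> makes the real inner
  product return the imaginary part of the scalar.\<close>

lemma vector_scalar_mult_inner_imaginary:
  fixes v :: "complex^'n"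
  shows "(l *s v) \<bullet> (\<i> *s v) = Im l * (norm v)\<^sup>2"
proof -
  have "(l * a) \<bullet> (\<i> * a) = Im l * (a \<bullet> a)" for a
    by (simp add: inner_complex_def algebra_simps)
  then show ?thesis
    by (simp add: inner_vec_def power2_norm_eq_inner sum_distrib_left)
qed

lemma norm_matrix_vector_le_onorm:
  fixes M :: "complex^'n^'m"
  shows "norm (M *v x) \<le> onorm ((*v) M) * norm x"
  by (intro onorm matrix_vector_mul_bounded_linear)

text \<open>Cauchy-Schwarz for \<open>(M *v u) \<bullet> w\<close> with
  \<open>u = conj_transpose M *v w\<close>; one factor \<open>norm u\<close> cancels.\<close>

lemma norm_adjoint_vector_le:
  fixes M :: "complex^'n^'m"
  shows "norm (conj_transpose M *v w) \<le> onorm ((*v) M) * norm w"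
proof -
  let ?u = "conj_transpose M *v w"
  have "(norm ?u)\<^sup>2 = (M *v ?u) \<bullet> w"
    by (simp add: inner_matrix_vector_adjoint power2_norm_eq_inner)
  also have "\<dots> \<le> norm (M *v ?u) * norm w"
    by (rule norm_cauchy_schwarz)
  also have "\<dots> \<le> (onorm ((*v) M) * norm ?u) * norm w"
    by (intro mult_right_mono norm_matrix_vector_le_onorm) auto
  finally have "norm ?u * norm ?u \<le> (onorm ((*v) M) * norm w) * norm ?u"
    by (simp add: power2_eq_square mult_ac)
  then show ?thesis
    by (cases "norm ?u = 0")
      (auto simp: onorm_pos_le[OF matrix_vector_mul_bounded_linear])
qed

lemma mult_vec_scaleR:
  fixes M :: "complex^'n^'m"
  shows "M *v (r *\<^sub>R x) = r *\<^sub>R (M *v x)"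
  by (simp add: vec_eq_iff matrix_vector_mult_def scaleR_sum_right)

text \<open>The unit sphere is compact, and by homogeneity the maximum there controls all
  vectors.\<close>

lemma onorm_attained:
  fixes M :: "complex^'n^'m"
  obtains v where "norm v = 1" "norm (M *v v) = onorm ((*v) M)"
proof -
  have "compact (sphere (0::complex^'n) 1)" "sphere (0::complex^'n) 1 \<noteq> {}"
    by simp_all
  moreover have "continuous_on (sphere 0 1) (\<lambda>v. norm (M *v v))"
    by (intro continuous_intros linear_continuous_on matrix_vector_mul_bounded_linear)
  ultimately obtain v where v: "v \<in> sphere 0 1"
      and max: "\<And>x. x \<in> sphere 0 1 \<Longrightarrow> norm (M *v x) \<le> norm (M *v v)"
    using continuous_attains_sup[of "sphere 0 1" "\<lambda>v. norm (M *v v)"] by blast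
  have "norm (M *v x) \<le> norm (M *v v) * norm x" for x
  proof (cases "x = 0")
    case False
    then have "norm (M *v (x /\<^sub>R norm x)) \<le> norm (M *v v)"
      by (intro max) simp
    then show ?thesis
      using False by (simp add: mult_vec_scaleR divide_inverse_commute[symmetric] divide_le_eq)
  qed simp
  then have "onorm ((*v) M) \<le> norm (M *v v)"
    by (rule onorm_le)
  moreover have "norm (M *v v) \<le> onorm ((*v) M)"
    using norm_matrix_vector_le_onorm[of M v] v by simp
  ultimately show ?thesis
    using that[of v] v by simp
qed

text \<open>A unit vector \<open>v\<close> at which the norm \<open>s\<close> is attained is an
  eigenvector: its image \<open>T\<close> under the Gram matrix has norm at most \<open>s^2\<close>
  and inner product \<open>s^2\<close> with \<open>v\<close>, so the squared norm of
  \<open>T - s^2 v\<close> is at most \<open>s^4 - 2 s^4 + s^4 = 0\<close>.\<close>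

lemma eigenvalue_gram_onorm:
  fixes M :: "complex^'n^'n"
  shows "eigenvalue (conj_transpose M ** M) (complex_of_real ((onorm ((*v) M))\<^sup>2))"
proof -
  let ?s = "onorm ((*v) M)"
  obtain v where v: "norm v = 1" "norm (M *v v) = ?s"
    by (rule onorm_attained)
  let ?T = "(conj_transpose M ** M) *v v"
  have "norm ?T \<le> ?s * ?s"
    using norm_adjoint_vector_le[of M "M *v v"] v by (simp add: matrix_vector_mul_assoc)
  then have "(norm ?T)\<^sup>2 \<le> (?s\<^sup>2)\<^sup>2"
    by (intro power_mono) (auto simp: power2_eq_square)
  moreover have "?T \<bullet> v = ?s\<^sup>2"
    by (simp add: inner_gram v flip: power2_norm_eq_inner)
  moreover have "(norm (?T - ?s\<^sup>2 *\<^sub>R v))\<^sup>2 = (norm ?T)\<^sup>2 - 2 * ?s\<^sup>2 * (?T \<bullet> v) + (?s\<^sup>2)\<^sup>2 * (norm v)\<^sup>2"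
    unfolding power2_norm_eq_inner
    by (simp add: inner_diff_left inner_diff_right inner_commute algebra_simps power2_eq_square)
  ultimately have "(norm (?T - ?s\<^sup>2 *\<^sub>R v))\<^sup>2 \<le> 0"
    using v by (simp add: power2_eq_square)
  then have "?T = ?s\<^sup>2 *\<^sub>R v"
    by simp
  also have "\<dots> = complex_of_real (?s\<^sup>2) *s v"
    by (rule of_real_vector_scalar_mult [symmetric])
  finally show ?thesis
    using v unfolding eigenvalue_def by (metis norm_zero zero_neq_one)
qed

lemma Re_eigenvalue_gram_le:
  fixes M :: "complex^'n^'n"
  assumes "eigenvalue (conj_transpose M ** M) l"
  shows "Re l \<le> (onorm ((*v) M))\<^sup>2"
proof -
  obtain v where v: "v \<noteq> 0" "(conj_transpose M ** M) *v v = l *s v"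
    using assms unfolding eigenvalue_def by blast
  have "Re l * (norm v)\<^sup>2 = (norm (M *v v))\<^sup>2"
    by (metis inner_gram power2_norm_eq_inner v(2) vector_scalar_mult_inner_self)
  also have "\<dots> \<le> (onorm ((*v) M) * norm v)\<^sup>2"
    by (intro power_mono norm_matrix_vector_le_onorm) auto
  finally show ?thesis
    using v by (simp add: power_mult_distrib)
qed

text \<open>The imaginary part of \<open>l\<close> is a multiple of the real inner product of
  \<open>M *v v\<close> with \<open>\<i>\<close> times itself, which vanishes.\<close>

lemma eigenvalue_gram_real:
  fixes M :: "complex^'n^'n"
  assumes "v \<noteq> 0" "(conj_transpose M ** M) *v v = l *s v"
  shows "(conj_transpose M ** M) *v v = Re l *\<^sub>R v"
proof -
  have "Im l * (norm v)\<^sup>2 = (M *v v) \<bullet> (M *v (\<i> *s v))"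
    by (metis inner_gram assms(2) vector_scalar_mult_inner_imaginary)
  also have "\<dots> = (1 *s (M *v v)) \<bullet> (\<i> *s (M *v v))"
    by (simp add: vector_scalar_commute)
  also have "\<dots> = 0"
    unfolding vector_scalar_mult_inner_imaginary by simp
  finally have "Im l = 0"
    using assms(1) by simp
  then have "l = complex_of_real (Re l)"
    by (simp add: complex_eq_iff)
  then have "l *s v = Re l *\<^sub>R v"
    by (metis of_real_vector_scalar_mult)
  then show ?thesis
    using assms by simp
qed

text \<open>Finiteness gives \<open>Max\<close> its meaning. Eigenvectors of the Gram matrix for
  distinct real eigenvalues are orthogonal, hence independent over the reals in a finite-dimensional
  space.\<close>

lemma finite_singular_values:
  fixes M :: "complex^'n^'n"
  shows "finite (singular_values M)"
proof -
  define S where "S = {Re l | l. eigenvalue (conj_transpose M ** M) l}"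
  have "\<exists>v. v \<noteq> 0 \<and> (conj_transpose M ** M) *v v = r *\<^sub>R v" if "r \<in> S" for r
    using that eigenvalue_gram_real unfolding S_def eigenvalue_def by blast
  then obtain v where v0: "\<And>r. r \<in> S \<Longrightarrow> v r \<noteq> 0"
      and v: "\<And>r. r \<in> S \<Longrightarrow> (conj_transpose M ** M) *v v r = r *\<^sub>R v r"
    by metis
  have orth: "v r \<bullet> v q = 0" if "r \<in> S" "q \<in> S" "r \<noteq> q" for r q
  proof -
    have "(r *\<^sub>R v r) \<bullet> v q = v r \<bullet> (q *\<^sub>R v q)"
      by (metis inner_gram inner_commute v that(1,2))
    then show ?thesis
      using that(3) by simp
  qed
  have inj: "inj_on v S"
    by (rule inj_onI) (metis orth v0 inner_eq_zero_iff)
  have "pairwise orthogonal (v ` S)"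
    using orth by (auto simp: pairwise_def orthogonal_def)
  then have "independent (v ` S)"
    using v0 by (intro pairwise_orthogonal_independent) auto
  then have "finite S"
    using inj finite_imageD independent_bound by blast
  moreover have "singular_values M = sqrt ` S"
    unfolding singular_values_def S_def by auto
  ultimately show ?thesis
    by simp
qed

text \<open>The squared norm is an eigenvalue of the Gram matrix, and no eigenvalue has a larger
  real part.\<close>

lemma max_singular_value_eq_onorm:
  fixes M :: "complex^'n^'n"
  shows "max_singular_value M = onorm ((*v) M)"
proof -
  have s: "0 \<le> onorm ((*v) M)"
    by (intro onorm_pos_le matrix_vector_mul_bounded_linear)
  have "onorm ((*v) M) \<in> singular_values M"
    unfolding singular_values_def using eigenvalue_gram_onorm[of M] s
    by (force intro!: exI[of _ "complex_of_real ((onorm ((*v) M))\<^sup>2)"])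
  moreover have "x \<le> onorm ((*v) M)" if "x \<in> singular_values M" for x
    using that Re_eigenvalue_gram_le[of M] s unfolding singular_values_def
    by (auto intro: real_le_lsqrt)
  ultimately show ?thesis
    unfolding max_singular_value_def by (intro Max_eqI finite_singular_values) auto
qed

lemma max_singular_value_nonneg:
  fixes M :: "complex^'n^'n"
  shows "0 \<le> max_singular_value M"
  unfolding max_singular_value_eq_onorm by (intro onorm_pos_le matrix_vector_mul_bounded_linear)

lemma norm_matrix_vector_le:
  fixes M :: "complex^'n^'n"
  shows "norm (M *v x) \<le> max_singular_value M * norm x"
  unfolding max_singular_value_eq_onorm by (rule norm_matrix_vector_le_onorm)

lemma max_singular_value_le:
  fixes M :: "complex^'n^'n"
  assumes "\<And>x. norm (M *v x) \<le> c * norm x"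
  shows "max_singular_value M \<le> c"
  unfolding max_singular_value_eq_onorm using assms by (rule onorm_le)

text \<open>Sending a matrix to its operator is linear on a finite-dimensional space, hence
  continuous; the norm of that operator is the maximum singular value.\<close>

lemma continuous_on_max_singular_value:
  fixes F :: "'a::topological_space \<Rightarrow> complex^'n^'n"
  assumes "continuous_on S F"
  shows "continuous_on S (\<lambda>t. max_singular_value (F t))"
proof -
  let ?B = "\<lambda>M::complex^'n^'n. Blinfun ((*v) M)"
  have "linear ?B"
    by (intro linearI blinfun_eqI)
      (auto simp: bounded_linear_Blinfun_apply blinfun.add_left blinfun.scaleR_left
        matrix_vector_mult_add_rdistrib matrix_vector_mult_def vec_eq_iff scaleR_sum_right
        algebra_simps sum.distrib)
  then have "continuous_on UNIV ?B"
    by (simp add: linear_continuous_on linear_conv_bounded_linear)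
  then have "continuous_on S (\<lambda>t. norm (?B (F t)))"
    using assms by (intro continuous_intros) (auto intro: continuous_on_compose2)
  then show ?thesis
    by (simp add: norm_blinfun.rep_eq bounded_linear_Blinfun_apply max_singular_value_eq_onorm)
qed

section \<open>Block vectors and block matrices\<close>

definition stack_vec :: "'a^'n \<Rightarrow> 'a^'m \<Rightarrow> 'a^('n + 'm)" where
  "stack_vec x y = (\<chi> i. case i of Inl a \<Rightarrow> x $ a | Inr b \<Rightarrow> y $ b)"

lemma stack_vec_nth [simp]:
  "stack_vec x y $ Inl i = x $ i" "stack_vec x y $ Inr j = y $ j"
  by (simp_all add: stack_vec_def)

lemma vec_sum_eq_iff:
  fixes u v :: "'a^('n::finite + 'm::finite)"
  shows "u = v \<longleftrightarrow> (\<forall>i. u $ Inl i = v $ Inl i) \<and> (\<forall>j. u $ Inr j = v $ Inr j)"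
  unfolding vec_eq_iff by (metis sum.exhaust)

lemma stack_vec_cases:
  fixes v :: "'a^('n::finite + 'm::finite)"
  obtains x y where "v = stack_vec x y"
  using that[of "\<chi> i. v $ Inl i" "\<chi> j. v $ Inr j"] by (simp add: vec_sum_eq_iff)

lemma ex_stack_vec: "(\<exists>v. P v) \<longleftrightarrow> (\<exists>x y. P (stack_vec x y))"
  by (metis stack_vec_cases)

lemma stack_vec_eq_iff [simp]: "stack_vec x y = stack_vec x' y' \<longleftrightarrow> x = x' \<and> y = y'"
  unfolding vec_sum_eq_iff by (simp add: vec_eq_iff)

lemma stack_vec_eq_0_iff [simp]: "stack_vec x y = 0 \<longleftrightarrow> x = 0 \<and> y = 0"
  unfolding vec_sum_eq_iff by (simp add: vec_eq_iff)

lemma stack_vec_add: "stack_vec x y + stack_vec x' y' = stack_vec (x + x') (y + y')"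
  unfolding vec_sum_eq_iff by simp

lemma sum_UNIV_sum:
  fixes f :: "'a::finite + 'b::finite \<Rightarrow> 'c::comm_monoid_add"
  shows "sum f UNIV = (\<Sum>i\<in>UNIV. f (Inl i)) + (\<Sum>j\<in>UNIV. f (Inr j))"
  using sum.Plus[of UNIV UNIV f] by simp

lemma norm_stack_vec:
  fixes x :: "complex^'n" and y :: "complex^'m"
  shows "(norm (stack_vec x y))\<^sup>2 = (norm x)\<^sup>2 + (norm y)\<^sup>2"
  by (simp add: power2_norm_eq_inner inner_vec_def sum_UNIV_sum)

lemma row_block_mult_vec:
  "row_block A B *v stack_vec x y = A *v x + B *v y"
  by (simp add: vec_eq_iff matrix_vector_mult_def row_block_def sum_UNIV_sum)

lemma col_block_mult_vec:
  "col_block A B *v x = stack_vec (A *v x) (B *v x)"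
  unfolding vec_sum_eq_iff by (simp add: matrix_vector_mult_def col_block_def)

lemma block_mult_vec:
  "block A B C D *v stack_vec x y = stack_vec (A *v x + B *v y) (C *v x + D *v y)"
  by (simp add: block_def col_block_mult_vec row_block_mult_vec)

lemma mat_mult_vec:
  fixes x :: "'a::comm_semiring_1^'n"
  shows "mat c *v x = c *s x"
  by (simp add: vec_eq_iff matrix_vector_mult_def mat_def if_distrib if_distribR cong: if_cong)

lemma scaleR_mult_vec:
  fixes M :: "complex^'n^'m"
  shows "(r *\<^sub>R M) *v x = r *\<^sub>R (M *v x)"
  by (simp add: vec_eq_iff matrix_vector_mult_def scaleR_sum_right)

text \<open>Moves the scaling \<open>1 / \<gamma>\<close> of the program from the plant into the
  full block of the uncertainty.\<close>

lemma block_diag_mult: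
  fixes D :: "'a::comm_ring_1^'n^'n"
  shows "block (mat 1) 0 0 (mat c) ** block (mat d :: 'a^'n^'n) 0 0 D = block (mat d) 0 0 (mat c ** D)"
  unfolding matrix_eq
proof
  fix v :: "'a^('n + 'n)"
  show "(block (mat 1) 0 0 (mat c) ** block (mat d :: 'a^'n^'n) 0 0 D) *v v =
    block (mat d) 0 0 (mat c ** D) *v v"
    by (cases v rule: stack_vec_cases)
      (simp add: block_mult_vec flip: matrix_vector_mul_assoc)
qed

text \<open>The blocks act on orthogonal components. The next three lemmas conclude that the norm of
  the block diagonal matrix is the larger of \<open>\<bar>d\<bar>\<close> and the norm of
  \<open>D\<close>.\<close>

lemma norm_block_diag_mult_vec:
  fixes D :: "complex^'n^'n"
  shows "(norm (block (mat (complex_of_real d) :: complex^'n^'n) 0 0 D *v stack_vec x y))\<^sup>2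
    = (\<bar>d\<bar> * norm x)\<^sup>2 + (norm (D *v y))\<^sup>2"
  by (simp add: block_mult_vec norm_stack_vec mat_mult_vec of_real_vector_scalar_mult)

lemma abs_le_max_singular_value_block_diag:
  fixes D :: "complex^'n^'n"
  shows "\<bar>d\<bar> \<le> max_singular_value (block (mat (complex_of_real d) :: complex^'n^'n) 0 0 D)"
    (is "_ \<le> max_singular_value ?B")
proof -
  obtain x :: "complex^'n" where x: "norm x = 1"
    by (rule vector_choose_size[of 1]) auto
  have "(norm (?B *v stack_vec x 0))\<^sup>2 = \<bar>d\<bar>\<^sup>2"
    using norm_block_diag_mult_vec[of d D x 0] x by simp
  then have "norm (?B *v stack_vec x 0) = \<bar>d\<bar>"
    by (rule power2_eq_imp_eq) auto
  moreover have "norm (stack_vec x (0::complex^'n)) = 1"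
    using norm_stack_vec[of x "0::complex^'n"] x by (intro power2_eq_imp_eq[of "norm _" 1]) auto
  ultimately show ?thesis
    using norm_matrix_vector_le[of ?B "stack_vec x 0"] by simp
qed

lemma max_singular_value_le_block_diag:
  fixes D :: "complex^'n^'n"
  shows "max_singular_value D \<le> max_singular_value (block (mat (complex_of_real d) :: complex^'n^'n) 0 0 D)"
    (is "_ \<le> max_singular_value ?B")
proof (rule max_singular_value_le)
  fix y :: "complex^'n"
  have "(norm (D *v y))\<^sup>2 = (norm (?B *v stack_vec 0 y))\<^sup>2"
    by (simp add: norm_block_diag_mult_vec)
  moreover have "(norm (stack_vec (0::complex^'n) y))\<^sup>2 = (norm y)\<^sup>2"
    by (simp add: norm_stack_vec)
  ultimately show "norm (D *v y) \<le> max_singular_value ?B * norm y"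
    using norm_matrix_vector_le[of ?B "stack_vec 0 y"]
    by (simp add: power2_eq_iff_nonneg)
qed

lemma max_singular_value_block_diag_le:
  fixes D :: "complex^'n^'n"
  assumes "\<bar>d\<bar> \<le> c" "max_singular_value D \<le> c"
  shows "max_singular_value (block (mat (complex_of_real d) :: complex^'n^'n) 0 0 D) \<le> c"
    (is "max_singular_value ?B \<le> c")
proof (rule max_singular_value_le)
  fix v :: "complex^('n + 'n)"
  obtain x y where v: "v = stack_vec x y"
    by (rule stack_vec_cases)
  have c: "0 \<le> c"
    using assms(1) by simp
  have "norm (D *v y) \<le> c * norm y"
    using norm_matrix_vector_le[of D y] assms(2)
    by (meson mult_right_mono norm_ge_zero order_trans)
  then have "(norm (?B *v v))\<^sup>2 \<le> (c * norm x)\<^sup>2 + (c * norm y)\<^sup>2"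
    unfolding v norm_block_diag_mult_vec using assms(1)
    by (intro add_mono power_mono mult_right_mono) auto
  also have "\<dots> = (c * norm v)\<^sup>2"
    by (simp add: v norm_stack_vec power_mult_distrib algebra_simps)
  finally show "norm (?B *v v) \<le> c * norm v"
    by (rule power2_le_imp_le) (simp add: c)
qed

section \<open>Continuity of the matrix inverse\<close>

lemma matrix_inv_mult_vec:
  fixes M :: "'a::field^'n^'n"
  assumes "det M \<noteq> 0"
  shows "M *v (matrix_inv M *v x) = x" "matrix_inv M *v (M *v x) = x"
proof -
  have "invertible M"
    using assms by (simp add: invertible_det_nz)
  then have "M ** matrix_inv M = mat 1 \<and> matrix_inv M ** M = mat 1"
    unfolding invertible_def matrix_inv_def by (rule someI_ex)
  then show "M *v (matrix_inv M *v x) = x" "matrix_inv M *v (M *v x) = x"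
    by (simp_all add: matrix_vector_mul_assoc)
qed

lemma matrix_inv_eqI:
  fixes M N :: "'a::field^'n^'n"
  assumes "det M \<noteq> 0" "\<And>x. M *v (N *v x) = x"
  shows "matrix_inv M = N"
  unfolding matrix_eq using assms matrix_inv_mult_vec(2)[OF assms(1)] by metis

lemma mult_vec_axis_nth:
  fixes M :: "'a::semiring_1^'n^'m"
  shows "(M *v axis j 1) $ i = M $ i $ j"
  by (simp add: matrix_vector_mult_def axis_def if_distrib cong: if_cong)

lemma det_eq_0_iff_kernel:
  fixes M :: "'a::field^'n^'n"
  shows "det M = 0 \<longleftrightarrow> (\<exists>x. x \<noteq> 0 \<and> M *v x = 0)"
  using invertible_det_nz[of M] matrix_left_invertible_ker[of M]
  by (auto simp: invertible_left_inverse)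

lemma continuous_on_det:
  fixes F :: "'a::topological_space \<Rightarrow> complex^'n^'n"
  assumes "continuous_on S F"
  shows "continuous_on S (\<lambda>t. det (F t))"
  unfolding det_def using assms by (intro continuous_intros)

text \<open>By Cramer's rule each entry of the inverse is a quotient of determinants.\<close>

lemma continuous_on_matrix_inv:
  fixes F :: "'a::topological_space \<Rightarrow> complex^'n^'n"
  assumes F: "continuous_on S F" and nz: "\<And>t. t \<in> S \<Longrightarrow> det (F t) \<noteq> 0"
  shows "continuous_on S (\<lambda>t. matrix_inv (F t))"
proof -
  let ?G = "\<lambda>t. \<chi> i j. det (\<chi> k l. if l = i then axis j 1 $ k else F t $ k $ l) / det (F t)"
  have "continuous_on S (\<lambda>t. (\<chi> k l. if l = i then axis j 1 $ k else F t $ k $ l) :: complex^'n^'n)"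
    for i j
  proof (intro continuous_on_vec_lambda)
    fix k l
    show "continuous_on S (\<lambda>t. if l = i then axis j 1 $ k else F t $ k $ l)"
      using F by (cases "l = i") (auto intro!: continuous_intros)
  qed
  then have "continuous_on S ?G"
    using F nz by (intro continuous_on_vec_lambda continuous_on_divide) (auto intro: continuous_on_det)
  moreover have "matrix_inv (F t) = ?G t" if "t \<in> S" for t
  proof -
    \<comment> \<open>Column \<open>j\<close> of the inverse solves the linear system with
      right-hand side \<open>axis j 1\<close>.\<close>
    have "matrix_inv (F t) *v axis j 1 =
      (\<chi> i. det (\<chi> k l. if l = i then axis j 1 $ k else F t $ k $ l) / det (F t))" for j
      using cramer[OF nz[OF that]] matrix_inv_mult_vec(1)[OF nz[OF that]] by blast
    then show ?thesis
      by (simp add: mult_vec_axis_nth vec_eq_iff)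
  qed
  ultimately show ?thesis
    by (metis (no_types, lifting) continuous_on_cong)
qed

section \<open>The feedback loop\<close>

text \<open>Multiplying by \<open>1 + \<delta>\<close> removes the singularity of \<open>(1 - \<delta>) / (1 + \<delta>)\<close> at \<open>\<delta> = -1\<close>.\<close>

definition pencil :: "real^'n^'n \<Rightarrow> complex \<Rightarrow> real \<Rightarrow> complex^'n^'n" where
  "pencil A s d = mat (complex_of_real (1 + d) * (s + 1)) - (1 - d) *\<^sub>R cmat A"

text \<open>The transfer matrix seen by the full block once the \<open>d\<close>-channel is
  closed.\<close>

definition loop_matrix :: "real^'n^'n \<Rightarrow> complex \<Rightarrow> real \<Rightarrow> complex^'n^'n" where
  "loop_matrix A s d = (1 + d) *\<^sub>R matrix_inv (pencil A s d)"

lemma pencil_mult_vec: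
  "pencil A s d *v x = (1 + d) *\<^sub>R ((s + 1) *s x) - (1 - d) *\<^sub>R (cmat A *v x)"
  unfolding pencil_def matrix_vector_mult_diff_rdistrib mat_mult_vec scaleR_mult_vec
    vector_smult_assoc[symmetric] of_real_vector_scalar_mult ..

text \<open>At \<open>d = 0\<close> the pencil is the matrix inverted in
  \<open>transfer_P\<close>.\<close>

lemma pencil_0: "pencil A s 0 = mat s - (cmat A - mat 1)"
  unfolding matrix_eq
  by (simp add: pencil_mult_vec matrix_vector_mult_diff_rdistrib mat_mult_vec vector_sadd_rdistrib)

text \<open>For \<open>d < 1\<close> a kernel vector would be an eigenvector of \<open>A\<close> for
  \<open>(1 + d) / (1 - d) * (s + 1)\<close>, whose real part is nonnegative, against stability. At
  \<open>d = 1\<close> the pencil is \<open>2 (s + 1)\<close> times the identity.\<close>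

lemma det_pencil_nonzero:
  assumes "stable A" "0 \<le> Re s" "d \<in> {-1..1}"
  shows "det (pencil A s d) \<noteq> 0"
proof
  assume "det (pencil A s d) = 0"
  then obtain x where x: "x \<noteq> 0" "pencil A s d *v x = 0"
    unfolding det_eq_0_iff_kernel by blast
  then have eq: "(1 - d) *\<^sub>R (cmat A *v x) = (1 + d) *\<^sub>R ((s + 1) *s x)"
    by (simp add: pencil_mult_vec)
  show False
  proof (cases "d = 1")
    case True
    then have "(s + 1) *s x = 0"
      using eq by simp
    then have "s + 1 = 0"
      using x(1) vector_mul_eq_0 by blast
    then show False
      using assms(2) by (simp add: complex_eq_iff)
  next
    case False
    let ?l = "complex_of_real ((1 + d) / (1 - d)) * (s + 1)"
    have "cmat A *v x = (1 / (1 - d)) *\<^sub>R ((1 - d) *\<^sub>R (cmat A *v x))"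
      using False by simp
    also have "\<dots> = ((1 + d) / (1 - d)) *\<^sub>R ((s + 1) *s x)"
      unfolding eq by simp
    also have "\<dots> = ?l *s x"
      unfolding vector_smult_assoc[symmetric] of_real_vector_scalar_mult ..
    finally have "Re ?l < 0"
      using assms(1) x(1) unfolding stable_def eigenvalue_def by blast
    moreover have "0 \<le> Re ?l"
      using assms(2,3) by simp
    ultimately show False
      by simp
  qed
qed

text \<open>The pencil is \<open>1 + d\<close> times the matrix inverted in
  \<open>resolvent\<close>. At \<open>d = -1\<close> the factor \<open>1 + d\<close> reproduces the
  convention that the resolvent is zero.\<close>

lemma resolvent_eq_loop_matrix:
  assumes nz: "det (pencil A (\<i> * complex_of_real \<omega>) d) \<noteq> 0"
  shows "resolvent A \<omega> d = loop_matrix A (\<i> * complex_of_real \<omega>) d"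
proof (cases "d = -1")
  case True
  then show ?thesis
    by (simp add: resolvent_def loop_matrix_def)
next
  case False
  then have d: "1 + d \<noteq> 0"
    by simp
  let ?s = "\<i> * complex_of_real \<omega>"
  let ?R = "mat ?s - (((1 - d) / (1 + d)) *\<^sub>R cmat A - mat 1)"
  have R: "(1 + d) *\<^sub>R (?R *v x) = pencil A ?s d *v x" for x
    using d by (simp add: pencil_mult_vec matrix_vector_mult_diff_rdistrib mat_mult_vec
        vector_sadd_rdistrib scaleR_mult_vec scaleR_add_right scaleR_diff_right diff_diff_eq2
        matrix_vector_mult_add_rdistrib)
  have "det ?R \<noteq> 0"
    using nz unfolding det_eq_0_iff_kernel R[symmetric] by auto
  moreover have "?R *v (loop_matrix A ?s d *v x) = x" for x
    using R[of "matrix_inv (pencil A ?s d) *v x"] matrix_inv_mult_vec(1)[OF nz, of x]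
    by (simp add: loop_matrix_def scaleR_mult_vec mult_vec_scaleR)
  ultimately show ?thesis
    using False unfolding resolvent_def by (simp add: matrix_inv_eqI)
qed

lemma uminus_mult_vec:
  fixes M :: "complex^'n^'m"
  shows "(- M) *v x = - (M *v x)"
  using scaleR_mult_vec[of "-1" M x] by simp

text \<open>The state-space equations of the plant, free of inverses: \<open>v\<close> is both the
  state and the second output.\<close>

lemma transfer_P_mult_vec:
  fixes A :: "real^'n^'n"
  assumes "det (pencil A s 0) \<noteq> 0"
  shows "transfer_P A s *v stack_vec u w = stack_vec z v \<longleftrightarrow>
    pencil A s 0 *v v = sqrt 2 *\<^sub>R u + w \<and> z = - u - sqrt 2 *\<^sub>R (cmat A *v v)"
proof -
  let ?v = "matrix_inv (pencil A s 0) *v (sqrt 2 *\<^sub>R u + w)"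
  have "transfer_P A s *v stack_vec u w = stack_vec (- u - sqrt 2 *\<^sub>R (cmat A *v ?v)) ?v"
    unfolding transfer_P_def pencil_0[symmetric]
    by (simp add: matrix_vector_mult_add_rdistrib block_mult_vec col_block_mult_vec
        row_block_mult_vec scaleR_mult_vec stack_vec_add uminus_mult_vec
        flip: matrix_vector_mul_assoc)
  moreover have "?v = v \<longleftrightarrow> pencil A s 0 *v v = sqrt 2 *\<^sub>R u + w"
    using matrix_inv_mult_vec[OF assms] by metis
  ultimately show ?thesis
    by auto
qed

lemma singular_iff_fixed_point:
  fixes M :: "complex^'n^'n"
  shows "det (mat 1 - M ** D) = 0 \<longleftrightarrow> (\<exists>v. v \<noteq> 0 \<and> M *v (D *v v) = v)"
  by (auto simp: det_eq_0_iff_kernel matrix_vector_mult_diff_rdistrib matrix_vector_mul_assoc)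

lemma eq_uminus_diff_iff:
  fixes a b c :: "'a::ab_group_add"
  shows "a = - b - c \<longleftrightarrow> a + b = - c"
  by (simp only: eq_diff_eq eq_neg_iff_add_eq_0 add_ac)

text \<open>The outputs \<open>z\<close> and \<open>v\<close> are fed back as
  \<open>d *\<^sub>R z\<close> and \<open>E *v v\<close>. Leaving \<open>1 + d\<close> as a factor
  avoids a division, so \<open>d = -1\<close> is included.\<close>

lemma singular_loop_iff:
  fixes A :: "real^'n^'n" and E :: "complex^'n^'n"
  assumes "det (pencil A s 0) \<noteq> 0"
  shows "det (mat 1 - transfer_P A s ** block (mat (complex_of_real d)) 0 0 E) = 0 \<longleftrightarrow>
    (\<exists>z v. (z \<noteq> 0 \<or> v \<noteq> 0) \<and> pencil A s 0 *v v = (sqrt 2 * d) *\<^sub>R z + E *v v \<and>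
      (1 + d) *\<^sub>R z = - (sqrt 2 *\<^sub>R (cmat A *v v)))"
proof -
  have *: "transfer_P A s *v (block (mat (complex_of_real d)) 0 0 E *v stack_vec z v) = stack_vec z v
    \<longleftrightarrow> pencil A s 0 *v v = (sqrt 2 * d) *\<^sub>R z + E *v v \<and>
      (1 + d) *\<^sub>R z = - (sqrt 2 *\<^sub>R (cmat A *v v))" for z v
  proof -
    have "block (mat (complex_of_real d)) 0 0 E *v stack_vec z v = stack_vec (d *\<^sub>R z) (E *v v)"
      by (simp add: block_mult_vec mat_mult_vec of_real_vector_scalar_mult)
    then show ?thesis
      by (simp only: transfer_P_mult_vec[OF assms] scaleR_scaleR eq_uminus_diff_iff
          scaleR_left_distrib scaleR_one)
  qed
  show ?thesis
    unfolding singular_iff_fixed_point ex_stack_vec * stack_vec_eq_0_iff by blast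
qed

text \<open>The assumption turns the \<open>z\<close> term into \<open>2 d\<close> times
  \<open>cmat A *v v\<close>, and \<open>(1 + d) - 2 d = 1 - d\<close> is the coefficient in the
  pencil at \<open>d\<close>.\<close>

lemma pencil_loop_elimination:
  assumes "(1 + d) *\<^sub>R z = - (sqrt 2 *\<^sub>R (cmat A *v v))"
  shows "(1 + d) *\<^sub>R (pencil A s 0 *v v - (sqrt 2 * d) *\<^sub>R z) = pencil A s d *v v"
proof -
  let ?q = "cmat A *v v"
  have "(1 + d) *\<^sub>R (sqrt 2 * d) *\<^sub>R z = (sqrt 2 * d) *\<^sub>R (1 + d) *\<^sub>R z"
    by (simp add: mult_ac)
  also have "\<dots> = - ((2 * d) *\<^sub>R ?q)"
    unfolding assms by simp
  finally have "(1 + d) *\<^sub>R (pencil A s 0 *v v - (sqrt 2 * d) *\<^sub>R z) =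
      (1 + d) *\<^sub>R ((s + 1) *s v) - ((1 + d) *\<^sub>R ?q - (2 * d) *\<^sub>R ?q)"
    unfolding scaleR_diff_right pencil_mult_vec by simp
  also have "(1 + d) *\<^sub>R ?q - (2 * d) *\<^sub>R ?q = (1 - d) *\<^sub>R ?q"
    by (simp flip: scaleR_left_diff_distrib)
  finally show ?thesis
    by (simp add: pencil_mult_vec)
qed

text \<open>A small-gain argument: eliminating \<open>z\<close> leaves a nonzero fixed point
  \<open>v\<close> of the loop matrix composed with \<open>E\<close>.\<close>

lemma singular_loop_gain_ge_1:
  fixes A :: "real^'n^'n" and E :: "complex^'n^'n"
  assumes nz0: "det (pencil A s 0) \<noteq> 0" and nz: "det (pencil A s d) \<noteq> 0"
    and sing: "det (mat 1 - transfer_P A s ** block (mat (complex_of_real d)) 0 0 E) = 0"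
  shows "1 \<le> max_singular_value (loop_matrix A s d) * max_singular_value E"
proof -
  obtain z v where zv: "z \<noteq> 0 \<or> v \<noteq> 0"
      and v: "pencil A s 0 *v v = (sqrt 2 * d) *\<^sub>R z + E *v v"
      and z: "(1 + d) *\<^sub>R z = - (sqrt 2 *\<^sub>R (cmat A *v v))"
    using sing unfolding singular_loop_iff[OF nz0] by blast
  \<comment> \<open>Since \<open>d\<close> and \<open>1 + d\<close> do not vanish together,
    \<open>v = 0\<close> would force \<open>z = 0\<close>.\<close>
  have "v \<noteq> 0"
  proof
    assume "v = 0"
    then have "z \<noteq> 0" "(sqrt 2 * d) *\<^sub>R z = 0" "(1 + d) *\<^sub>R z = 0"
      using zv v z by auto
    then show False
      by auto
  qed
  have "(1 + d) *\<^sub>R (E *v v) = pencil A s d *v v"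
    using pencil_loop_elimination[OF z, of s] by (simp add: v)
  then have "v = matrix_inv (pencil A s d) *v ((1 + d) *\<^sub>R (E *v v))"
    by (simp add: matrix_inv_mult_vec(2)[OF nz])
  then have "v = loop_matrix A s d *v (E *v v)"
    by (simp add: loop_matrix_def scaleR_mult_vec mult_vec_scaleR)
  then have "norm v \<le> max_singular_value (loop_matrix A s d) * norm (E *v v)"
    by (metis norm_matrix_vector_le)
  also have "\<dots> \<le> max_singular_value (loop_matrix A s d) * (max_singular_value E * norm v)"
    by (intro mult_left_mono norm_matrix_vector_le max_singular_value_nonneg)
  finally show ?thesis
    using \<open>v \<noteq> 0\<close> by simp
qed

text \<open>Cauchy-Schwarz for the full Hermitian product, of which \<open>\<bullet>\<close> is only
  the real part.\<close>

lemma norm_cnj_mult_sum_le: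
  fixes y v :: "complex^'n"
  shows "cmod (\<Sum>i\<in>UNIV. cnj (y $ i) * v $ i) \<le> norm y * norm v"
proof -
  have "cmod (\<Sum>i\<in>UNIV. cnj (y $ i) * v $ i) \<le> (\<Sum>i\<in>UNIV. \<bar>cmod (y $ i)\<bar> * \<bar>cmod (v $ i)\<bar>)"
    by (rule order_trans[OF norm_sum]) (simp add: norm_mult)
  also have "\<dots> \<le> norm y * norm v"
    unfolding norm_vec_def by (rule L2_set_mult_ineq)
  finally show ?thesis .
qed

text \<open>The witness is \<open>u\<close> times the conjugate transpose of
  \<open>y\<close>.\<close>

lemma exists_rank_one_matrix:
  fixes u y :: "complex^'n"
  assumes "norm y = 1"
  obtains E :: "complex^'n^'n" where "E *v y = u" "max_singular_value E \<le> norm u"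
proof
  let ?E = "(\<chi> i j. u $ i * cnj (y $ j)) :: complex^'n^'n"
  have E: "?E *v v = (\<Sum>j\<in>UNIV. cnj (y $ j) * v $ j) *s u" for v
    by (simp add: vec_eq_iff matrix_vector_mult_def sum_distrib_left mult_ac)
  have "cnj a * a = complex_of_real ((cmod a)\<^sup>2)" for a
    by (subst complex_norm_square) (rule mult.commute)
  moreover have "(norm y)\<^sup>2 = (\<Sum>j\<in>UNIV. (cmod (y $ j))\<^sup>2)"
    by (simp add: norm_vec_def L2_set_def sum_nonneg)
  ultimately have "(\<Sum>j\<in>UNIV. cnj (y $ j) * y $ j) = complex_of_real ((norm y)\<^sup>2)"
    by simp
  then show "?E *v y = u"
    by (simp add: E assms)
  show "max_singular_value ?E \<le> norm u"
  proof (rule max_singular_value_le)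
    fix v
    have "norm (c *s u) = cmod c * norm u" for c
      unfolding norm_vec_def vector_smult_component norm_mult
      by (rule L2_set_right_distrib [symmetric]) simp
    moreover have "cmod (\<Sum>j\<in>UNIV. cnj (y $ j) * v $ j) \<le> norm v"
      using norm_cnj_mult_sum_le[of y v] assms by simp
    ultimately show "norm (?E *v v) \<le> norm u * norm v"
      unfolding E by (metis mult.commute mult_left_mono norm_ge_zero)
  qed
qed

text \<open>With \<open>H\<close> the loop matrix and \<open>u\<close> a unit vector attaining its norm \<open>f\<close>, the matrix \<open>E\<close>
  of rank one that maps \<open>H u / f\<close> to \<open>u / f\<close> makes \<open>H E\<close> fix \<open>H u / f\<close>.\<close>

lemma exists_singular_loop:
  fixes A :: "real^'n^'n"
  assumes nz0: "det (pencil A s 0) \<noteq> 0" and nz: "det (pencil A s d) \<noteq> 0"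
    and pos: "0 < max_singular_value (loop_matrix A s d)"
  obtains E :: "complex^'n^'n"
  where "det (mat 1 - transfer_P A s ** block (mat (complex_of_real d)) 0 0 E) = 0"
    "max_singular_value E \<le> 1 / max_singular_value (loop_matrix A s d)"
proof -
  let ?H = "loop_matrix A s d" and ?f = "max_singular_value (loop_matrix A s d)"
  obtain u where u: "norm u = 1" "norm (?H *v u) = ?f"
    using onorm_attained[of ?H] unfolding max_singular_value_eq_onorm by blast
  define y where "y = (1 / ?f) *\<^sub>R (?H *v u)"
  have y: "norm y = 1"
    using u pos by (simp add: y_def)
  obtain E where E: "E *v y = (1 / ?f) *\<^sub>R u" "max_singular_value E \<le> norm ((1 / ?f) *\<^sub>R u)"
    by (rule exists_rank_one_matrix[OF y])
  \<comment> \<open>At \<open>d = -1\<close> the loop matrix vanishes, against the positive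
    gain.\<close>
  have d: "1 + d \<noteq> 0"
  proof
    assume "1 + d = 0"
    then have "?H *v u = 0"
      by (simp add: loop_matrix_def scaleR_mult_vec)
    then show False
      using u pos by simp
  qed
  \<comment> \<open>Obtained by solving the second loop equation for \<open>z\<close>.\<close>
  define z where "z = - ((sqrt 2 / (1 + d)) *\<^sub>R (cmat A *v y))"
  have z: "(1 + d) *\<^sub>R z = - (sqrt 2 *\<^sub>R (cmat A *v y))"
    using d by (simp add: z_def)
  have "pencil A s d *v (?H *v u) = (1 + d) *\<^sub>R u"
    by (simp add: loop_matrix_def scaleR_mult_vec mult_vec_scaleR matrix_inv_mult_vec(1)[OF nz])
  then have "pencil A s d *v y = (1 + d) *\<^sub>R (E *v y)"
    unfolding E(1) by (simp add: y_def mult_vec_scaleR)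
  then have "(1 + d) *\<^sub>R (pencil A s 0 *v y - (sqrt 2 * d) *\<^sub>R z) = (1 + d) *\<^sub>R (E *v y)"
    using pencil_loop_elimination[OF z, of s] by simp
  then have "pencil A s 0 *v y = (sqrt 2 * d) *\<^sub>R z + E *v y"
    using d by (simp add: diff_eq_eq add.commute)
  moreover have "y \<noteq> 0"
    using y by auto
  ultimately have "det (mat 1 - transfer_P A s ** block (mat (complex_of_real d)) 0 0 E) = 0"
    unfolding singular_loop_iff[OF nz0] using z by blast
  moreover have "max_singular_value E \<le> 1 / ?f"
    using E(2) u pos by simp
  ultimately show ?thesis
    by (rule that)
qed

section \<open>Continuity and positivity of the loop gain\<close>

lemma continuous_on_pencil:
  fixes A :: "real^'n^'n"
  shows "continuous_on S (pencil A s)"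
proof -
  have eq: "pencil A s = (\<lambda>d. \<chi> i j. (if i = j then complex_of_real (1 + d) * (s + 1) else 0)
      - (1 - d) *\<^sub>R complex_of_real (A $ i $ j))"
    by (simp only: fun_eq_iff pencil_def vec_eq_iff mat_def vector_minus_component
        vector_scaleR_component vec_lambda_beta nth_map_matrix simp_thms)
  show ?thesis
    unfolding eq
  proof (intro continuous_on_vec_lambda continuous_on_diff)
    fix i j :: 'n
    show "continuous_on S (\<lambda>d. if i = j then complex_of_real (1 + d) * (s + 1) else 0)"
      by (cases "i = j") (simp_all add: continuous_on_add continuous_on_mult continuous_on_of_real)
  qed (intro continuous_intros)
qed

lemma continuous_on_loop_gain:
  assumes "\<And>d. d \<in> S \<Longrightarrow> det (pencil A s d) \<noteq> 0"
  shows "continuous_on S (\<lambda>d. max_singular_value (loop_matrix A s d))"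
  unfolding loop_matrix_def
  by (rule continuous_on_max_singular_value, rule continuous_on_scaleR,
      intro continuous_intros, rule continuous_on_matrix_inv[OF continuous_on_pencil assms])

text \<open>The loop matrix is a nonzero multiple of an invertible matrix. Used at
  \<open>d = 1\<close> to see that \<open>kappa\<close> is positive.\<close>

lemma loop_gain_pos:
  fixes A :: "real^'n^'n"
  assumes "det (pencil A s d) \<noteq> 0" "d \<noteq> -1"
  shows "0 < max_singular_value (loop_matrix A s d)"
proof (rule ccontr)
  assume "\<not> ?thesis"
  then have f: "max_singular_value (loop_matrix A s d) = 0"
    using max_singular_value_nonneg[of "loop_matrix A s d"] by simp
  have zero: "x = 0" for x :: "complex^'n"
  proof -
    have "loop_matrix A s d *v x = 0"
      using norm_matrix_vector_le[of "loop_matrix A s d" x] f by simp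
    then have "(1 + d) *\<^sub>R (matrix_inv (pencil A s d) *v x) = 0"
      by (simp add: loop_matrix_def scaleR_mult_vec)
    then have "matrix_inv (pencil A s d) *v x = 0"
      using assms(2) by simp
    then show "x = 0"
      using matrix_inv_mult_vec(1)[OF assms(1), of x] by simp
  qed
  obtain x :: "complex^'n" where "norm x = 1"
    by (rule vector_choose_size[of 1]) auto
  then show False
    using zero[of x] by simp
qed

section \<open>The structured singular value of the scaled loop\<close>

lemma max_singular_value_mat_mult_le:
  fixes M :: "complex^'n^'n"
  assumes "0 \<le> c"
  shows "max_singular_value (mat (complex_of_real c) ** M) \<le> c * max_singular_value M"
proof (rule max_singular_value_le)
  fix x
  have "norm (mat (complex_of_real c) ** M *v x) = c * norm (M *v x)"
    using assms
    by (simp add: mat_mult_vec of_real_vector_scalar_mult flip: matrix_vector_mul_assoc)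
  also have "\<dots> \<le> c * (max_singular_value M * norm x)"
    using assms by (intro mult_left_mono norm_matrix_vector_le)
  finally show "norm (mat (complex_of_real c) ** M *v x) \<le> c * max_singular_value M * norm x"
    by simp
qed

text \<open>If no admissible \<open>D\<close> makes the loop singular, the infimum is infinite with
  inverse zero, so this case needs no separate treatment.\<close>

lemma mu_le:
  assumes "0 < R"
    and "\<And>D. D \<in> uncertainty_set \<Longrightarrow> det (mat 1 - M ** D) = 0 \<Longrightarrow> R \<le> max_singular_value D"
  shows "mu M \<le> ereal (1 / R)"
proof -
  let ?I = "Inf {ereal (max_singular_value D) | D. D \<in> uncertainty_set \<and> det (mat 1 - M ** D) = 0}"
  have "ereal R \<le> ?I"
    using assms(2) by (intro Inf_greatest) auto
  then have "inverse ?I \<le> inverse (ereal R)"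
    using assms(1) by (intro ereal_inverse_antimono) auto
  then show ?thesis
    using assms(1) by (simp add: mu_def divide_ereal_def inverse_eq_divide)
qed

lemma mu_ge_1:
  assumes "D \<in> uncertainty_set" "det (mat 1 - M ** D) = 0" "max_singular_value D \<le> 1"
  shows "1 \<le> mu M"
proof -
  let ?I = "Inf {ereal (max_singular_value D) | D. D \<in> uncertainty_set \<and> det (mat 1 - M ** D) = 0}"
  have "?I \<le> ereal (max_singular_value D)"
    using assms(1,2) by (intro Inf_lower) auto
  also have "\<dots> \<le> 1"
    using assms(3) by simp
  finally have "?I \<le> 1" .
  \<comment> \<open>Inversion on \<open>ereal\<close> reverses the order only among nonnegative
    values; a zero infimum gives an infinite \<open>mu\<close>.\<close>
  moreover have "0 \<le> ?I"
    by (intro Inf_greatest) (auto simp: max_singular_value_nonneg)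
  ultimately have "inverse 1 \<le> inverse ?I"
    by (intro ereal_inverse_antimono)
  then show ?thesis
    by (simp add: mu_def divide_ereal_def one_ereal_def)
qed

text \<open>For a singular loop either \<open>\<bar>d\<bar>\<close> already reaches
  \<open>R\<close>, or the small-gain bound for \<open>E\<close> scaled by \<open>1 / c\<close>,
  combined with \<open>gain\<close>, forces the norm of \<open>E\<close> to reach
  \<open>R\<close>.\<close>

lemma mu_scaled_transfer_le:
  fixes A :: "real^'n^'n"
  assumes R: "0 < R" and c: "0 < c" and nz0: "det (pencil A s 0) \<noteq> 0"
    and nz: "\<And>d. \<bar>d\<bar> < R \<Longrightarrow> det (pencil A s d) \<noteq> 0"
    and gain: "\<And>d. \<bar>d\<bar> < R \<Longrightarrow> R * max_singular_value (loop_matrix A s d) \<le> c"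
  shows "mu (transfer_P A s ** block (mat 1) 0 0 (mat (complex_of_real (1 / c)))) \<le> ereal (1 / R)"
proof (rule mu_le[OF R])
  fix D :: "complex^('n + 'n)^('n + 'n)"
  assume "D \<in> uncertainty_set"
    and sing: "det (mat 1 - transfer_P A s ** block (mat 1) 0 0 (mat (complex_of_real (1 / c))) ** D) = 0"
  then obtain d and E :: "complex^'n^'n" where D: "D = block (mat (complex_of_real d)) 0 0 E"
    unfolding uncertainty_set_def by blast
  show "R \<le> max_singular_value D"
  proof (cases "\<bar>d\<bar> < R")
    case False
    then show ?thesis
      using abs_le_max_singular_value_block_diag[of d E] by (simp add: D)
  next
    case True
    let ?f = "max_singular_value (loop_matrix A s d)"
    have "1 \<le> ?f * max_singular_value (mat (complex_of_real (1 / c)) ** E)"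
      using sing unfolding D matrix_mul_assoc[symmetric] block_diag_mult
      by (rule singular_loop_gain_ge_1[OF nz0 nz[OF True]])
    also have "\<dots> \<le> ?f * (1 / c * max_singular_value E)"
      using c by (intro mult_left_mono max_singular_value_mat_mult_le max_singular_value_nonneg) auto
    finally have "c \<le> ?f * max_singular_value E"
      using c by (simp add: field_simps)
    then have "R * c \<le> (R * ?f) * max_singular_value E"
      using R by simp
    also have "\<dots> \<le> c * max_singular_value E"
      using gain[OF True] by (intro mult_right_mono max_singular_value_nonneg)
    finally have "R \<le> max_singular_value E"
      using c by simp
    then show ?thesis
      using max_singular_value_le_block_diag[of E d] by (simp add: D)
  qed
qed

text \<open>Scaling the \<open>E\<close> of \<open>exists_singular_loop\<close> by \<open>c\<close>
  cancels the factor \<open>1 / c\<close> in the plant, and the norm stays at most 1 because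
  \<open>c\<close> does not exceed the gain.\<close>

lemma mu_scaled_transfer_ge_1:
  fixes A :: "real^'n^'n"
  assumes c: "0 < c" "c \<le> max_singular_value (loop_matrix A s d)" and d: "\<bar>d\<bar> \<le> 1"
    and nz0: "det (pencil A s 0) \<noteq> 0" and nz: "det (pencil A s d) \<noteq> 0"
  shows "1 \<le> mu (transfer_P A s ** block (mat 1) 0 0 (mat (complex_of_real (1 / c))))"
proof -
  let ?f = "max_singular_value (loop_matrix A s d)"
  have "0 < ?f"
    using c by simp
  then obtain E :: "complex^'n^'n"
    where sing: "det (mat 1 - transfer_P A s ** block (mat (complex_of_real d)) 0 0 E) = 0"
      and E: "max_singular_value E \<le> 1 / ?f"
    by (rule exists_singular_loop[OF nz0 nz])
  let ?D = "mat (complex_of_real c) ** E"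
  have "max_singular_value ?D \<le> c * (1 / ?f)"
    using c E by (intro order_trans[OF max_singular_value_mat_mult_le] mult_left_mono) auto
  also have "\<dots> \<le> 1"
    using c by simp
  finally have "max_singular_value ?D \<le> 1" .
  have "mat (complex_of_real (1 / c)) ** ?D = E"
    using c unfolding matrix_eq
    by (simp add: mat_mult_vec vector_smult_assoc flip: matrix_vector_mul_assoc)
  then have "det (mat 1 - transfer_P A s ** block (mat 1) 0 0 (mat (complex_of_real (1 / c)))
      ** block (mat (complex_of_real d)) 0 0 ?D) = 0"
    using sing unfolding matrix_mul_assoc[symmetric, of "transfer_P A s"] block_diag_mult by simp
  then show ?thesis
  proof (rule mu_ge_1[rotated])
    show "block (mat (complex_of_real d)) 0 0 ?D \<in> uncertainty_set"
      unfolding uncertainty_set_def by blast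
    show "max_singular_value (block (mat (complex_of_real d) :: complex^'n^'n) 0 0 ?D) \<le> 1"
      using d \<open>max_singular_value ?D \<le> 1\<close> by (rule max_singular_value_block_diag_le)
  qed
qed

text \<open>Nonsingularity and a strict gain bound are open conditions on \<open>d\<close>, so they
  spread from the compact interval to a uniform neighbourhood.\<close>

lemma exists_gain_bound_beyond_unit:
  assumes nz: "\<And>d. d \<in> {-1..1} \<Longrightarrow> det (pencil A s d) \<noteq> 0"
    and le: "\<And>d. d \<in> {-1..1} \<Longrightarrow> max_singular_value (loop_matrix A s d) \<le> k"
    and k: "0 < k" "k < c"
  obtains R where "1 < R" "\<And>d. \<bar>d\<bar> < R \<Longrightarrow> det (pencil A s d) \<noteq> 0"
    "\<And>d. \<bar>d\<bar> < R \<Longrightarrow> R * max_singular_value (loop_matrix A s d) \<le> c"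
proof -
  let ?f = "\<lambda>d. max_singular_value (loop_matrix A s d)"
  \<comment> \<open>The midpoint leaves room on both sides: the gain may grow from \<open>k\<close>
    to \<open>c'\<close> outside the interval, and the factor \<open>R\<close> may take
    \<open>c'\<close> up to \<open>c\<close>.\<close>
  define c' where "c' = (k + c) / 2"
  have c': "k < c'" "c' < c" "0 < c'"
    using k by (auto simp: c'_def)
  define V where "V = {d. det (pencil A s d) \<noteq> 0}"
  have "open V"
    unfolding V_def
    by (intro open_Collect_neq continuous_on_det continuous_on_pencil continuous_on_const)
  moreover have "continuous_on V ?f"
    by (rule continuous_on_loop_gain) (simp add: V_def)
  ultimately have "open (V \<inter> ?f -` {..<c'})"
    by (intro continuous_open_preimage open_lessThan)
  moreover have "{-1..1} \<subseteq> V \<inter> ?f -` {..<c'}"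
    using nz le c' by (force simp: V_def)
  ultimately obtain e where e: "0 < e" "(\<Union>x\<in>{-1..1}. ball x e) \<subseteq> V \<inter> ?f -` {..<c'}"
    using compact_subset_open_imp_ball_epsilon_subset[OF compact_Icc] by blast
  \<comment> \<open>The first bound keeps \<open>d\<close> within \<open>e\<close> of the interval,
    the second gives \<open>R * c' \<le> c\<close>.\<close>
  define R where "R = min (1 + e) (c / c')"
  have "1 < R"
    using e c' by (simp add: R_def)
  have R: "det (pencil A s d) \<noteq> 0 \<and> ?f d < c'" if "\<bar>d\<bar> < R" for d
  proof -
    have "\<bar>d\<bar> < 1 + e"
      using that by (simp add: R_def)
    \<comment> \<open>The centre is the point of the interval nearest to \<open>d\<close>.\<close>
    then have "d \<in> ball (max (-1) (min 1 d)) e"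
      using e(1) by (auto simp: dist_real_def max_def min_def)
    moreover have "max (-1) (min 1 d) \<in> {-1..1}"
      by auto
    ultimately show ?thesis
      using e(2) unfolding V_def by blast
  qed
  show ?thesis
  proof (rule that[OF \<open>1 < R\<close>])
    fix d
    assume d: "\<bar>d\<bar> < R"
    then show "det (pencil A s d) \<noteq> 0"
      using R by blast
    have "R * ?f d \<le> (c / c') * c'"
      using R[OF d] c' \<open>1 < R\<close> max_singular_value_nonneg
      by (intro mult_mono) (auto simp: R_def)
    then show "R * ?f d \<le> c"
      using c' by simp
  qed
qed

theorem theorem2:
  fixes A :: "real^'n^'n" and \<omega> :: real
  assumes "stable A" and "\<omega> \<ge> 0"
  shows "(\<exists>d\<in>{-1..1}. max_singular_value (resolvent A \<omega> d) = kappa A \<omega>)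
       \<and> (\<forall>d\<in>{-1..1}. max_singular_value (resolvent A \<omega> d) \<le> kappa A \<omega>)
       \<and> ((\<lambda>\<epsilon>. gamma_opt A \<omega> \<epsilon>) \<longlongrightarrow> ereal (kappa A \<omega>)) (at_right 0)"
proof -
  let ?s = "\<i> * complex_of_real \<omega>"
  let ?f = "\<lambda>d. max_singular_value (loop_matrix A ?s d)"
  have nz: "det (pencil A ?s d) \<noteq> 0" if "d \<in> {-1..1}" for d
    using assms(1) _ that by (rule det_pencil_nonzero) simp
  have nz0: "det (pencil A ?s 0) \<noteq> 0"
    by (intro nz) simp
  have f: "max_singular_value (resolvent A \<omega> d) = ?f d" if "d \<in> {-1..1}" for d
    using nz[OF that] by (simp add: resolvent_eq_loop_matrix)
  have "continuous_on {-1..1} ?f"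
    using nz by (rule continuous_on_loop_gain)
  then obtain d0 where d0: "d0 \<in> {-1..1}" and max: "\<And>d. d \<in> {-1..1} \<Longrightarrow> ?f d \<le> ?f d0"
    using continuous_attains_sup[of "{-1..1}" ?f] by auto
  have kappa: "kappa A \<omega> = ?f d0"
    unfolding kappa_def using d0 max f by (intro cSup_eq_maximum) auto
  have "0 < ?f 1"
    by (intro loop_gain_pos nz) auto
  then have pos: "0 < kappa A \<omega>"
    using max[of 1] by (simp add: kappa)
  \<comment> \<open>At the maximizer \<open>d0\<close>, any \<open>\<gamma>\<close> not above
    \<open>kappa\<close> admits a singular loop of norm at most 1, so \<open>mu\<close> is at least
    1 and \<open>\<gamma>\<close> is infeasible.\<close>
  have lower: "ereal (kappa A \<omega>) \<le> gamma_opt A \<omega> \<epsilon>" if "0 < \<epsilon>" for \<epsilon>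
    unfolding gamma_opt_def
  proof (rule Inf_greatest, clarify)
    fix \<gamma> :: real
    assume "0 < \<gamma>" and feasible: "mu (transfer_P A ?s ** block (mat 1) 0 0 (mat (complex_of_real (1 / \<gamma>))))
      \<le> ereal (1 - \<epsilon>)"
    show "ereal (kappa A \<omega>) \<le> ereal \<gamma>"
    proof (rule ccontr)
      assume "\<not> ?thesis"
      then have "1 \<le> mu (transfer_P A ?s ** block (mat 1) 0 0 (mat (complex_of_real (1 / \<gamma>))))"
        using \<open>0 < \<gamma>\<close> d0 by (intro mu_scaled_transfer_ge_1[of \<gamma> A ?s d0] nz0 nz) (auto simp: kappa)
      also note feasible
      finally show False
        using that by (simp add: one_ereal_def)
    qed
  qed
  \<comment> \<open>Any \<open>c\<close> strictly between \<open>kappa\<close> and \<open>a\<close>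
    is feasible as soon as \<open>1 / R \<le> 1 - \<epsilon>\<close>, where \<open>R > 1\<close>
    depends on \<open>c\<close> but not on \<open>\<epsilon>\<close>.\<close>
  have upper: "\<forall>\<^sub>F \<epsilon> in at_right 0. gamma_opt A \<omega> \<epsilon> < a" if less: "ereal (kappa A \<omega>) < a" for a
  proof -
    obtain c where c: "kappa A \<omega> < c" "ereal c < a"
      using ereal_dense2[OF less] by auto
    obtain R where R: "1 < R" "\<And>d. \<bar>d\<bar> < R \<Longrightarrow> det (pencil A ?s d) \<noteq> 0"
      "\<And>d. \<bar>d\<bar> < R \<Longrightarrow> R * ?f d \<le> c"
    proof (rule exists_gain_bound_beyond_unit[OF nz _ pos c(1)])
      show "?f d \<le> kappa A \<omega>" if "d \<in> {-1..1}" for d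
        using max[OF that] by (simp add: kappa)
    qed auto
    have "gamma_opt A \<omega> \<epsilon> < a" if "\<epsilon> < 1 - 1 / R" for \<epsilon>
    proof -
      have "mu (transfer_P A ?s ** block (mat 1) 0 0 (mat (complex_of_real (1 / c)))) \<le> ereal (1 / R)"
        using R pos c nz0 by (intro mu_scaled_transfer_le) auto
      also have "\<dots> \<le> ereal (1 - \<epsilon>)"
        using that by simp
      finally have "gamma_opt A \<omega> \<epsilon> \<le> ereal c"
        unfolding gamma_opt_def using pos c by (intro Inf_lower) auto
      then show ?thesis
        using c(2) by (rule le_less_trans)
    qed
    moreover have "\<forall>\<^sub>F \<epsilon> in at_right 0. \<epsilon> < 1 - 1 / R"
      using R(1) by (intro order_tendstoD[OF tendsto_ident_at]) simp
    ultimately show ?thesis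
      by (auto elim: eventually_mono)
  qed
  have "((\<lambda>\<epsilon>. gamma_opt A \<omega> \<epsilon>) \<longlongrightarrow> ereal (kappa A \<omega>)) (at_right 0)"
  proof (rule order_tendstoI)
    fix a
    assume "a < ereal (kappa A \<omega>)"
    then have "a < gamma_opt A \<omega> \<epsilon>" if "0 < \<epsilon>" for \<epsilon>
      using lower[OF that] by simp
    then show "\<forall>\<^sub>F \<epsilon> in at_right 0. a < gamma_opt A \<omega> \<epsilon>"
      by (auto intro: eventually_mono[OF eventually_at_right_less])
  qed (rule upper)
  then show ?thesis
    using d0 max f kappa by auto
qed

end
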